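(* As $n\to\infty$, $$|\mathrm{MSTD}(\mathbb{Z}/n\mathbb{Z} \times \mathbb{Z}/2\mathbb{Z})| \sim \begin{cases} 3^{n+1}, & \text{if } n \text{ is even},\\ 3^{n}, & \text{if } n \text{ is odd}.\end{cases}$$
   Context: For an abelian group $G$ and a subset $A\subset G$, let $A+A=\{a+b : a,b\in A\}$ and $A-A=\{a-b : a,b\in A\}$. A finite subset $A \subset G$ is an MSTD (more sums than differences) set if $|A+A| > |A-A|$. $\mathrm{MSTD}(G)$ denotes the collection of all MSTD sets $A\subset G$, and $|\mathrm{MSTD}(G)|$ the number of them. The notation $f_n \sim g_n$ means $f_n/g_n \to 1$ as $n\to\infty$. *)

theory Defs
  imports "HOL-Algebra.Elementary_Groups" "HOL-Library.Landau_Symbols"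
begin

(* HOL-Algebra writes groups multiplicatively: for an abelian group G, the operation
   "\<otimes>" plays the role of the paper's +, and "a \<otimes> inv b" that of a - b. *)

definition sumset :: "('a, 'b) monoid_scheme \<Rightarrow> 'a set \<Rightarrow> 'a set" where
  "sumset G A = {a \<otimes>\<^bsub>G\<^esub> b | a b. a \<in> A \<and> b \<in> A}"

definition diffset :: "('a, 'b) monoid_scheme \<Rightarrow> 'a set \<Rightarrow> 'a set" where
  "diffset G A = {a \<otimes>\<^bsub>G\<^esub> inv\<^bsub>G\<^esub> b | a b. a \<in> A \<and> b \<in> A}"

definition MSTD :: "('a, 'b) monoid_scheme \<Rightarrow> 'a set set" where
  "MSTD G = {A. A \<subseteq> carrier G \<and> finite A \<and> card (sumset G A) > card (diffset G A)}"

end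

theory Submission
  imports
    Defs
    "HOL-Algebra.Multiplicative_Group"
    "HOL-Number_Theory.Fib"
    "HOL-Real_Asymp.Real_Asymp"
begin

text \<open>
  Let \<open>G\<close> be a finite abelian group of order \<open>N\<close>. Almost every subset has the whole group both as its
  sumset and as its difference set, and the count of MSTD sets is governed by the cheapest way to
  miss one difference. A set misses the difference \<open>g\<close> iff it is independent in the graph joining
  each \<open>x\<close> to \<open>g \<otimes> x\<close>. If \<open>g\<close> is an involution this graph is a perfect matching and has exactly
  \<open>3\<^sup>N\<^sup>/\<^sup>2\<close> independent sets (\<open>card_avoiding_involution\<close>). If \<open>g\<close> has order at least three, it is a
  union of cycles of that length, and the number of independent sets is at most \<open>c\<^sup>N\<close> with
  \<open>c = 12/7 < 3\<^sup>1\<^sup>/\<^sup>2\<close> (\<open>card_avoiding_noninvolution\<close>). So up to an error of order \<open>N c\<^sup>N\<close>, the MSTD sets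
  are among those that miss an involution.

  Conversely, a set that misses an involution \<open>g\<close> is MSTD as soon as its sumset is everything. If
  it misses a sum \<open>s\<close> as well, it is independent also in the graph joining each \<open>x\<close> to
  \<open>s \<otimes> inv x\<close>. The two graphs together consist of 4-cycles, apart from the points \<open>x\<close> with \<open>x \<otimes> x\<close>
  equal to \<open>s\<close> or \<open>g \<otimes> s\<close>. Such points are few if the group has few involutions, so there are at most
  \<open>c\<^sup>N\<close> such sets up to a constant factor (\<open>card_avoiding_involution_and_sum\<close>).
  The same holds for the sets that miss two different involutions
  (\<open>card_avoiding_two_involutions\<close>), so the families belonging to different involutions hardly overlap.

  With \<open>t\<close> involutions, the number of MSTD sets is therefore \<open>t 3\<^sup>N\<^sup>/\<^sup>2\<close> up to an error that, for
  bounded \<open>t\<close>, is exponentially smaller (\<open>card_MSTD_le\<close>, \<open>card_MSTD_ge\<close>).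
  The product of the cyclic groups of orders \<open>n\<close> and two has order \<open>2 n\<close>, and it has three involutions if \<open>n\<close> is even but only one if \<open>n\<close> is odd.
\<close>

section \<open>Counting subsets block by block\<close>

text \<open>
  A set that satisfies a condition on each block of a partition is an independent choice of
  one admissible subset per block.
\<close>
lemma card_blockwise:
  assumes "finite P" "pairwise disjnt P"
  shows "card {A. A \<subseteq> \<Union>P \<and> (\<forall>B\<in>P. Q (A \<inter> B))} = (\<Prod>B\<in>P. card {A. A \<subseteq> B \<and> Q A})"
  using assms
proof (induction P rule: finite_induct)
  case empty
  then show ?case by simp
next
  case (insert B P)
  let ?L = "{A. A \<subseteq> \<Union>(insert B P) \<and> (\<forall>C\<in>insert B P. Q (A \<inter> C))}"
  let ?R = "{A. A \<subseteq> B \<and> Q A} \<times> {A. A \<subseteq> \<Union>P \<and> (\<forall>C\<in>P. Q (A \<inter> C))}"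
  have dj: "B \<inter> C = {}" if "C \<in> P" for C
    using insert.prems insert.hyps that by (auto simp: pairwise_insert disjnt_def)
  then have djU: "B \<inter> \<Union>P = {}" by blast
  have "bij_betw (\<lambda>A. (A \<inter> B, A \<inter> \<Union>P)) ?L ?R"
  proof (rule bij_betw_byWitness[where f' = "\<lambda>(X, Y). X \<union> Y"])
    show "\<forall>A\<in>?L. (case (A \<inter> B, A \<inter> \<Union>P) of (X, Y) \<Rightarrow> X \<union> Y) = A"
      by (simp add: Int_Un_distrib[symmetric] Int_absorb2)
    show "\<forall>XY\<in>?R. (\<lambda>A. (A \<inter> B, A \<inter> \<Union>P)) (case XY of (X, Y) \<Rightarrow> X \<union> Y) = XY"
    proof
      fix XY assume "XY \<in> ?R"
      then obtain X Y where XY: "XY = (X, Y)" "X \<subseteq> B" "Y \<subseteq> \<Union>P" by blast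
      have "(X \<union> Y) \<inter> B = X" "(X \<union> Y) \<inter> \<Union>P = Y" using XY djU by blast+
      then show "(\<lambda>A. (A \<inter> B, A \<inter> \<Union>P)) (case XY of (X, Y) \<Rightarrow> X \<union> Y) = XY"
        using XY(1) by simp
    qed
    show "(\<lambda>A. (A \<inter> B, A \<inter> \<Union>P)) ` ?L \<subseteq> ?R"
    proof clarsimp
      fix A C assume "\<forall>C\<in>P. Q (A \<inter> C)" "C \<in> P"
      moreover from \<open>C \<in> P\<close> have "A \<inter> \<Union>P \<inter> C = A \<inter> C" by auto
      ultimately show "Q (A \<inter> \<Union>P \<inter> C)" by simp
    qed
    show "(\<lambda>(X, Y). X \<union> Y) ` ?R \<subseteq> ?L"
    proof clarsimp
      fix X Y assume *: "X \<subseteq> B" "Q X" "Y \<subseteq> \<Union>P" "\<forall>C\<in>P. Q (Y \<inter> C)"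
      have "(X \<union> Y) \<inter> B = X" using * djU by auto
      moreover have "(X \<union> Y) \<inter> C = Y \<inter> C" if "C \<in> P" for C using * dj[OF that] by auto
      ultimately show "X \<subseteq> B \<union> \<Union>P \<and> Y \<subseteq> B \<union> \<Union>P \<and> Q ((X \<union> Y) \<inter> B) \<and> (\<forall>C\<in>P. Q ((X \<union> Y) \<inter> C))"
        using * by auto
    qed
  qed
  then have "card ?L = card ?R" by (rule bij_betw_same_card)
  also have "\<dots> = card {A. A \<subseteq> B \<and> Q A} * (\<Prod>B\<in>P. card {A. A \<subseteq> B \<and> Q A})"
    using insert by (simp add: card_cartesian_product pairwise_insert)
  finally show ?case using insert.hyps by simp
qed

lemma pairwise_disjnt_quotient:
  assumes "equiv V r"
  shows "pairwise disjnt (V // r)"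
  using quotient_disj[OF assms] unfolding pairwise_def disjnt_def by blast

lemma card_eq_sum_card_quotient:
  assumes "equiv V r" "finite V"
  shows "card V = (\<Sum>B\<in>V // r. card B)"
proof -
  have "finite B" if "B \<in> V // r" for B
    using finite_equiv_class[OF assms(2) equiv_type[OF assms(1)] that] .
  from card_Union_disjoint[OF pairwise_disjnt_quotient[OF assms(1)] this] show ?thesis
    by (simp add: Union_quotient[OF assms(1)])
qed

text \<open>
  The exponential bounds for subsets of a group come from this lemma: for a property inherited by
  subsets, a bound \<open>c\<close> per element need only be checked on the classes of a suitable equivalence
  relation, because the restrictions to the classes determine the set.
\<close>
lemma card_hereditary_le_power:
  fixes c :: real
  assumes "equiv V r" "finite V"
    and hered: "\<And>A B. Q A \<Longrightarrow> B \<subseteq> A \<Longrightarrow> Q B"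
    and block: "\<And>x. x \<in> V \<Longrightarrow> real (card {A. A \<subseteq> r `` {x} \<and> Q A}) \<le> c ^ card (r `` {x})"
  shows "real (card {A. A \<subseteq> V \<and> Q A}) \<le> c ^ card V"
proof -
  let ?P = "V // r"
  have fin: "finite ?P" using assms by (simp add: equiv_type finite_quotient)
  have un: "\<Union>?P = V" by (rule Union_quotient[OF assms(1)])
  have "{A. A \<subseteq> V \<and> Q A} \<subseteq> {A. A \<subseteq> \<Union>?P \<and> (\<forall>B\<in>?P. Q (A \<inter> B))}"
    unfolding un using hered by auto
  moreover have "finite {A. A \<subseteq> \<Union>?P \<and> (\<forall>B\<in>?P. Q (A \<inter> B))}"
    unfolding un by (rule finite_subset[of _ "Pow V"]) (use assms(2) in auto)
  ultimately have "card {A. A \<subseteq> V \<and> Q A} \<le> (\<Prod>B\<in>?P. card {A. A \<subseteq> B \<and> Q A})"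
    unfolding card_blockwise[OF fin pairwise_disjnt_quotient[OF assms(1)], symmetric]
    by (rule card_mono[rotated])
  then have "real (card {A. A \<subseteq> V \<and> Q A}) \<le> (\<Prod>B\<in>?P. real (card {A. A \<subseteq> B \<and> Q A}))"
    by (simp only: of_nat_le_iff flip: of_nat_prod)
  also have "\<dots> \<le> (\<Prod>B\<in>?P. c ^ card B)"
    by (intro prod_mono conjI) (auto elim!: quotientE intro: block)
  also have "\<dots> = c ^ card V"
    by (simp add: card_eq_sum_card_quotient[OF assms(1,2)] power_sum)
  finally show ?thesis .
qed

section \<open>Subsets of a path without adjacent vertices\<close>

lemma card_no_consecutive_le_fib:
  "card {S. S \<subseteq> {..<k} \<and> (\<forall>i\<in>S. Suc i \<notin> S)} \<le> fib (k + 2)"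
proof (induction k rule: fib.induct)
  case 1
  have "{S. S \<subseteq> {..<0::nat} \<and> (\<forall>i\<in>S. Suc i \<notin> S)} = {{}}" by auto
  then show ?case by simp
next
  case 2
  have "{S. S \<subseteq> {..<Suc 0} \<and> (\<forall>i\<in>S. Suc i \<notin> S)} \<subseteq> {{}, {0}}" by auto
  then have "card {S. S \<subseteq> {..<Suc 0} \<and> (\<forall>i\<in>S. Suc i \<notin> S)} \<le> card {{}, {0::nat}}"
    by (intro card_mono) auto
  then show ?case by (simp add: numeral_eq_Suc)
next
  case (3 k)
  let ?F = "\<lambda>k. {S. S \<subseteq> {..<k} \<and> (\<forall>i\<in>S. Suc i \<notin> S)}"
  have fin: "finite (?F m)" for m by (rule finite_subset[of _ "Pow {..<m}"]) auto
  have "?F (Suc (Suc k)) \<subseteq> ?F (Suc k) \<union> insert (Suc k) ` ?F k"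
  proof
    fix S assume S: "S \<in> ?F (Suc (Suc k))"
    show "S \<in> ?F (Suc k) \<union> insert (Suc k) ` ?F k"
    proof (cases "Suc k \<in> S")
      case False
      then show ?thesis using S by (auto simp: less_Suc_eq subset_iff)
    next
      case True
      then have "k \<notin> S" using S by auto
      then have "S - {Suc k} \<in> ?F k" using S by (auto simp: less_Suc_eq subset_iff)
      moreover have "S = insert (Suc k) (S - {Suc k})" using True by auto
      ultimately show ?thesis by blast
    qed
  qed
  then have "card (?F (Suc (Suc k))) \<le> card (?F (Suc k) \<union> insert (Suc k) ` ?F k)"
    by (intro card_mono finite_UnI finite_imageI fin)
  also have "\<dots> \<le> card (?F (Suc k)) + card (?F k)"
    using card_Un_le[of "?F (Suc k)" "insert (Suc k) ` ?F k"] card_image_le[OF fin, of "insert (Suc k)" k]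
    by linarith
  finally show ?case using 3 by simp
qed

text \<open>
  The rate \<open>12/7\<close> is a rational number between the growth rate \<open>5\<^sup>1\<^sup>/\<^sup>3\<close> of the shortest path
  considered here, which has three vertices and is the worst one, and \<open>3\<^sup>1\<^sup>/\<^sup>2\<close>, the rate of
  a single edge: \<open>(12/7)\<^sup>3 > 5\<close> while
  \<open>(12/7)\<^sup>2 = 144/49 < 3\<close>. Because it also exceeds the golden ratio, the bound propagates from three
  and four vertices along the Fibonacci recurrence.
\<close>
lemma fib_le_power:
  assumes "k \<ge> 3"
  shows "real (fib (k + 2)) \<le> (12 / 7) ^ k"
proof -
  have "real (fib (j + 5)) \<le> (12 / 7) ^ (j + 3)" for j
  proof (induction j rule: fib.induct)
    case (3 j)
    have "real (fib (Suc (Suc j) + 5)) = real (fib (Suc j + 5)) + real (fib (j + 5))"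
      by (simp only: add_Suc fib.simps of_nat_add)
    also have "\<dots> \<le> (12 / 7) ^ (Suc j + 3) + (12 / 7) ^ (j + 3)"
      using 3 by linarith
    also have "\<dots> = (12 / 7) ^ j * ((12 / 7) ^ 4 + (12 / 7) ^ 3)"
      by (simp add: power_add algebra_simps)
    also have "\<dots> \<le> (12 / 7) ^ j * (12 / 7) ^ 5"
      by (intro mult_left_mono) (simp_all add: eval_nat_numeral)
    also have "\<dots> = (12 / 7) ^ (Suc (Suc j) + 3)"
      by (simp add: power_add)
    finally show ?case .
  qed (simp_all add: eval_nat_numeral)
  moreover obtain j where j: "k = j + 3"
    using assms le_Suc_ex[of 3 k] by (metis add.commute)
  moreover have "j + 3 + 2 = j + 5" by simp
  ultimately show ?thesis by metis
qed

text \<open>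
  The enumeration \<open>p\<close> lays the block out as a path; admissible sets of vertices correspond to sets
  of indices without two consecutive members. Extra constraints imposed by \<open>Q\<close>, such as the edge
  closing the path to a cycle, can only lower the count.
\<close>
lemma card_path_free_le:
  assumes "inj_on p {..<k}" "k \<ge> 3"
    and path: "\<And>A i. Q A \<Longrightarrow> Suc i < k \<Longrightarrow> p i \<in> A \<Longrightarrow> p (Suc i) \<notin> A"
  shows "real (card {A. A \<subseteq> p ` {..<k} \<and> Q A}) \<le> (12 / 7) ^ card (p ` {..<k})"
proof -
  let ?F = "{S. S \<subseteq> {..<k} \<and> (\<forall>i\<in>S. Suc i \<notin> S)}"
  have "{A. A \<subseteq> p ` {..<k} \<and> Q A} \<subseteq> (`) p ` ?F"
  proof
    fix A assume A: "A \<in> {A. A \<subseteq> p ` {..<k} \<and> Q A}"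
    have "{i\<in>{..<k}. p i \<in> A} \<in> ?F" using A path by auto
    moreover have "A = p ` {i\<in>{..<k}. p i \<in> A}" using A by auto
    ultimately show "A \<in> (`) p ` ?F" by blast
  qed
  moreover have fin: "finite ?F" by (rule finite_subset[of _ "Pow {..<k}"]) auto
  ultimately have "card {A. A \<subseteq> p ` {..<k} \<and> Q A} \<le> card ?F"
    by (meson surj_card_le)
  then have "real (card {A. A \<subseteq> p ` {..<k} \<and> Q A}) \<le> real (fib (k + 2))"
    using card_no_consecutive_le_fib[of k] by linarith
  also have "\<dots> \<le> (12 / 7) ^ card (p ` {..<k})"
    using fib_le_power[OF assms(2)] card_image[OF assms(1)] by simp
  finally show ?thesis .
qed

section \<open>Sets disjoint from their image under involutions\<close>

text \<open>
  These are the independent sets of the graph that joins each \<open>x\<close> to \<open>f x\<close>, where a fixed point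
  of \<open>f\<close> is a loop and so belongs to no such set. For translation by \<open>g\<close> they are the sets that miss
  the difference \<open>g\<close>, and for the reflection \<open>x \<mapsto> s - x\<close> those that miss the sum \<open>s\<close>.
\<close>
definition step_free :: "('a \<Rightarrow> 'a) \<Rightarrow> 'a set \<Rightarrow> bool" where
  "step_free f A \<longleftrightarrow> (\<forall>a\<in>A. f a \<notin> A)"

lemma step_free_subset: "step_free f A \<Longrightarrow> B \<subseteq> A \<Longrightarrow> step_free f B"
  by (auto simp: step_free_def)

text \<open>
  The graph of a fixed-point-free involution is a perfect matching, and each of its edges
  allows three choices: neither end or exactly one of them.
\<close>
lemma card_step_free_involution:
  assumes "finite V" and inv: "\<And>x. x \<in> V \<Longrightarrow> f x \<in> V \<and> f (f x) = x \<and> f x \<noteq> x"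
  shows "card {A. A \<subseteq> V \<and> step_free f A} = 3 ^ (card V div 2)"
proof -
  define r where "r = {(x, y). x \<in> V \<and> (y = x \<or> y = f x)}"
  have eq: "equiv V r"
    using inv by (intro equivI refl_onI symI transI) (auto simp: r_def)
  let ?P = "V // r"
  have cls: "\<exists>x\<in>V. B = {x, f x}" if "B \<in> ?P" for B
    using that by (auto simp: quotient_def r_def)
  have fin: "finite ?P" using eq assms(1) by (simp add: equiv_type finite_quotient)
  have un: "\<Union>?P = V" by (rule Union_quotient[OF eq])
  have two: "card B = 2" if "B \<in> ?P" for B
    using cls[OF that] inv by (metis card_2_iff)
  have three: "card {A. A \<subseteq> B \<and> step_free f A} = 3" if "B \<in> ?P" for B
  proof -
    obtain x where x: "x \<in> V" "B = {x, f x}" using cls \<open>B \<in> ?P\<close> by blast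
    have "{A. A \<subseteq> B \<and> step_free f A} = {{}, {x}, {f x}}"
    proof -
      have "{A. A \<subseteq> B \<and> step_free f A} = {A \<in> Pow {x, f x}. step_free f A}"
        using x(2) by auto
      also have "\<dots> = {A \<in> {{}, {x}, {f x}, {x, f x}}. step_free f A}"
        by (auto simp: Pow_insert)
      also have "\<dots> = {{}, {x}, {f x}}"
        using inv[OF x(1)] by (auto simp: step_free_def)
      finally show ?thesis .
    qed
    moreover have "card {{}, {x}, {f x}} = 3"
      using inv[OF x(1)] by (metis card_3_iff insert_not_empty singleton_inject)
    ultimately show ?thesis by simp
  qed
  have "step_free f A \<longleftrightarrow> (\<forall>B\<in>?P. step_free f (A \<inter> B))" if "A \<subseteq> V" for A
  proof
    show "\<forall>B\<in>?P. step_free f (A \<inter> B)" if "step_free f A"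
      using that step_free_subset by blast
    assume *: "\<forall>B\<in>?P. step_free f (A \<inter> B)"
    show "step_free f A"
      unfolding step_free_def
    proof (intro ballI notI)
      fix a assume a: "a \<in> A" "f a \<in> A"
      then have "r `` {a} \<in> ?P" "a \<in> r `` {a}" "f a \<in> r `` {a}"
        using \<open>A \<subseteq> V\<close> by (auto simp: quotient_def r_def)
      with * a show False unfolding step_free_def by blast
    qed
  qed
  then have "{A. A \<subseteq> V \<and> step_free f A} = {A. A \<subseteq> \<Union>?P \<and> (\<forall>B\<in>?P. step_free f (A \<inter> B))}"
    unfolding un by blast
  then have "card {A. A \<subseteq> V \<and> step_free f A} = 3 ^ card ?P"
    using card_blockwise[OF fin pairwise_disjnt_quotient[OF eq], of "step_free f"] three by simp
  moreover have "card V = 2 * card ?P"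
    using card_eq_sum_card_quotient[OF eq assms(1)] two by simp
  ultimately show ?thesis by simp
qed

text \<open>
  The orbits of the group generated by \<open>f\<close> and \<open>h\<close> have four elements, and the two conditions
  together turn each orbit into a 4-cycle, which contains the path
  \<open>x, f x, h (f x), h x\<close>. A second missing sum or difference thus lowers the rate from \<open>3\<^sup>1\<^sup>/\<^sup>2\<close> to
  at most \<open>12/7\<close> per element.
\<close>
lemma card_step_free_commuting_involutions_generic:
  assumes "finite V"
    and f: "\<And>x. x \<in> V \<Longrightarrow> f x \<in> V \<and> f (f x) = x \<and> f x \<noteq> x"
    and h: "\<And>x. x \<in> V \<Longrightarrow> h x \<in> V \<and> h (h x) = x \<and> h x \<noteq> x \<and> h x \<noteq> f x"
    and comm: "\<And>x. x \<in> V \<Longrightarrow> h (f x) = f (h x)"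
  shows "real (card {A. A \<subseteq> V \<and> step_free f A \<and> step_free h A}) \<le> (12 / 7) ^ card V"
proof -
  define orb where "orb x = {x, f x, h x, h (f x)}" for x
  define r where "r = {(x, y). x \<in> V \<and> y \<in> orb x}"
  have orbit: "f (h x) = h (f x)" "f (h (f x)) = h x" "h (h (f x)) = f x" if "x \<in> V" for x
    using that f[of x] h[of x] h[of "f x"] f[of "h x"] comm[of x] by simp_all
  have orb_V: "orb x \<subseteq> V" if "x \<in> V" for x
    using that f h by (auto simp: orb_def)
  have orb_eq: "orb y = orb x" if x: "x \<in> V" and y: "y \<in> orb x" for x y
  proof -
    have ffx: "f (f x) = x" "h (h x) = x" using f[OF x] h[OF x] by auto
    from y consider "y = x" | "y = f x" | "y = h x" | "y = h (f x)" by (auto simp: orb_def)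
    then show ?thesis
      by cases (simp_all add: orb_def orbit[OF x] ffx insert_commute)
  qed
  have orb_self: "x \<in> orb x" for x by (simp add: orb_def)
  have eq: "equiv V r"
  proof (intro equivI refl_onI symI transI)
    show "r \<subseteq> V \<times> V" using orb_V unfolding r_def by blast
    show "(x, x) \<in> r" if "x \<in> V" for x using that orb_self by (simp add: r_def)
    show "(y, x) \<in> r" if "(x, y) \<in> r" for x y
      using that orb_eq orb_self orb_V unfolding r_def by blast
    show "(x, z) \<in> r" if "(x, y) \<in> r" "(y, z) \<in> r" for x y z
      using that orb_eq unfolding r_def by blast
  qed
  show ?thesis
  proof (rule card_hereditary_le_power[OF eq assms(1)])
    fix A B assume "step_free f A \<and> step_free h A" "B \<subseteq> A"
    then show "step_free f B \<and> step_free h B" by (blast intro: step_free_subset)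
  next
    fix x assume x: "x \<in> V"
    define p where "p i = [x, f x, h (f x), h x] ! i" for i
    have img: "r `` {x} = p ` {..<4}"
      using x by (auto simp: r_def orb_def p_def numeral_eq_Suc lessThan_Suc)
    have "h (f x) \<noteq> x" "h (f x) \<noteq> f x" "h (f x) \<noteq> h x"
      using x f[of x] h[of x] h[of "f x"] by metis+
    then have "distinct [x, f x, h (f x), h x]"
      using x f[of x] h[of x] by auto
    then have inj: "inj_on p {..<4}"
      by (auto simp: p_def inj_on_def nth_eq_iff_index_eq)
    have "real (card {A. A \<subseteq> p ` {..<4} \<and> (step_free f A \<and> step_free h A)})
        \<le> (12 / 7) ^ card (p ` {..<4})"
    proof (rule card_path_free_le[OF inj])
      fix A i assume A: "step_free f A \<and> step_free h A" and i: "Suc i < 4" "p i \<in> A"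
      from i(1) consider "i = 0" | "i = 1" | "i = 2" by linarith
      then show "p (Suc i) \<notin> A"
        using A i(2) orbit[OF x]
        by cases (auto simp: p_def step_free_def)
    qed simp
    then show "real (card {A. A \<subseteq> r `` {x} \<and> step_free f A \<and> step_free h A}) \<le> (12 / 7) ^ card (r `` {x})"
      unfolding img .
  qed
qed

text \<open>
  A reflection of an abelian group may fix points or agree with a translation at some points. The
  set of such points is a union of orbits, so the previous bound applies to its complement, while
  on the exceptional points themselves it suffices to count all subsets.
\<close>
lemma card_step_free_commuting_involutions:
  assumes "finite V"
    and f: "\<And>x. x \<in> V \<Longrightarrow> f x \<in> V \<and> f (f x) = x \<and> f x \<noteq> x"
    and h: "\<And>x. x \<in> V \<Longrightarrow> h x \<in> V \<and> h (h x) = x"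
    and comm: "\<And>x. x \<in> V \<Longrightarrow> h (f x) = f (h x)"
  shows "real (card {A. A \<subseteq> V \<and> step_free f A \<and> step_free h A})
      \<le> 2 ^ card {x\<in>V. h x = x \<or> h x = f x} * (12 / 7) ^ card V"
proof -
  define D where "D = {x\<in>V. h x = x \<or> h x = f x}"
  let ?Q = "\<lambda>A. step_free f A \<and> step_free h A"
  have finD: "finite D" using assms(1) by (simp add: D_def)
  have fV: "f x \<in> V - D \<and> f (f x) = x \<and> f x \<noteq> x" if "x \<in> V - D" for x
  proof -
    have x: "x \<in> V" "h x \<noteq> x" "h x \<noteq> f x" using that by (auto simp: D_def)
    have "h (f x) \<noteq> f x" "h (f x) \<noteq> f (f x)"
      using x f[of x] f[of "h x"] h[of x] comm[of x] by metis+
    then show ?thesis using f[OF x(1)] by (auto simp: D_def)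
  qed
  have hV: "h x \<in> V - D \<and> h (h x) = x \<and> h x \<noteq> x \<and> h x \<noteq> f x" if "x \<in> V - D" for x
  proof -
    have x: "x \<in> V" "h x \<noteq> x" "h x \<noteq> f x" using that by (auto simp: D_def)
    have "h (h x) \<noteq> h x" "h (h x) \<noteq> f (h x)"
      using x f[of "h x"] h[of x] by metis+
    then show ?thesis using h[OF x(1)] x by (auto simp: D_def)
  qed
  have fin: "finite (Pow D \<times> {A. A \<subseteq> V - D \<and> ?Q A})"
    by (rule finite_subset[of _ "Pow D \<times> Pow V"]) (use assms(1) finD in auto)
  have "card {A. A \<subseteq> V \<and> ?Q A} \<le> card (Pow D \<times> {A. A \<subseteq> V - D \<and> ?Q A})"
  proof (rule card_inj_on_le[where f = "\<lambda>A. (A \<inter> D, A - D)"])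
    show "inj_on (\<lambda>A. (A \<inter> D, A - D)) {A. A \<subseteq> V \<and> ?Q A}"
      by (rule inj_on_inverseI[where g = "\<lambda>(X, Y). X \<union> Y"]) auto
    show "(\<lambda>A. (A \<inter> D, A - D)) ` {A. A \<subseteq> V \<and> ?Q A} \<subseteq> Pow D \<times> {A. A \<subseteq> V - D \<and> ?Q A}"
      by (auto intro: step_free_subset)
  qed (rule fin)
  then have "real (card {A. A \<subseteq> V \<and> ?Q A}) \<le> real (2 ^ card D * card {A. A \<subseteq> V - D \<and> ?Q A})"
    unfolding card_cartesian_product card_Pow[OF finD] by (rule of_nat_mono)
  also have "\<dots> = 2 ^ card D * real (card {A. A \<subseteq> V - D \<and> ?Q A})" by simp
  also have "real (card {A. A \<subseteq> V - D \<and> ?Q A}) \<le> (12 / 7) ^ card (V - D)"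
    by (rule card_step_free_commuting_involutions_generic)
       (use assms(1) fV hV comm in auto)
  also have "(12 / 7 :: real) ^ card (V - D) \<le> (12 / 7) ^ card V"
    by (intro power_increasing card_mono) (use assms(1) in auto)
  finally show ?thesis by (simp add: D_def)
qed

section \<open>Missing differences and missing sums in a finite abelian group\<close>

context comm_group
begin

lemma not_in_diffset_iff:
  assumes "A \<subseteq> carrier G" "g \<in> carrier G"
  shows "g \<notin> diffset G A \<longleftrightarrow> step_free (\<lambda>x. g \<otimes> x) A"
proof -
  have "g = a \<otimes> inv b \<longleftrightarrow> g \<otimes> b = a" if "a \<in> A" "b \<in> A" for a b
    using inv_solve_right[of g a b] that assms by (metis subsetD)
  then have "g \<in> diffset G A \<longleftrightarrow> (\<exists>a\<in>A. \<exists>b\<in>A. g \<otimes> b = a)"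
    unfolding diffset_def mem_Collect_eq by metis
  then show ?thesis unfolding step_free_def by blast
qed

lemma not_in_sumset_iff:
  assumes "A \<subseteq> carrier G" "s \<in> carrier G"
  shows "s \<notin> sumset G A \<longleftrightarrow> step_free (\<lambda>x. s \<otimes> inv x) A"
proof -
  have "s = a \<otimes> b \<longleftrightarrow> s \<otimes> inv b = a" if "a \<in> A" "b \<in> A" for a b
    using inv_solve_right'[of a s b] that assms by (metis subsetD)
  then have "s \<in> sumset G A \<longleftrightarrow> (\<exists>a\<in>A. \<exists>b\<in>A. s \<otimes> inv b = a)"
    unfolding sumset_def mem_Collect_eq by metis
  then show ?thesis unfolding step_free_def by blast
qed

definition involutions :: "'a set" where
  "involutions = {g \<in> carrier G. g \<noteq> \<one> \<and> g \<otimes> g = \<one>}"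

text \<open>
  Translation by an element of order \<open>k \<ge> 3\<close> splits the group into cycles of length \<open>k\<close>, namely
  the cosets of the subgroup that it generates, and a cycle contains a path through all its
  vertices.
\<close>
lemma card_avoiding_noninvolution:
  assumes fin: "finite (carrier G)" and g: "g \<in> carrier G" "g \<otimes> g \<noteq> \<one>"
  shows "real (card {A. A \<subseteq> carrier G \<and> step_free (\<lambda>x. g \<otimes> x) A}) \<le> (12 / 7) ^ order G"
proof -
  let ?H = "generate G {g}"
  have sub: "subgroup ?H G" using g(1) by (simp add: generate_is_subgroup)
  have k3: "ord g \<ge> 3"
  proof -
    have "ord g \<noteq> 0" using ord_ge_1[OF fin g(1)] by linarith
    moreover have "ord g \<noteq> 1" using g ord_eq_1[OF g(1)] by auto
    moreover have "ord g \<noteq> 2"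
    proof
      assume "ord g = 2"
      then have "g [^] (2::nat) = \<one>" using pow_ord_eq_1[OF g(1)] by simp
      then show False using g by (simp add: numeral_2_eq_2)
    qed
    ultimately show ?thesis by linarith
  qed
  have ivl: "{0..ord g - 1} = {..<ord g}" using k3 by auto
  have H: "?H = (\<lambda>i. g [^] i) ` {..<ord g}"
    using generate_pow_on_finite_carrier[OF fin g(1)] ord_elems[OF fin g(1)] ivl by auto
  show ?thesis
    unfolding order_def
  proof (rule card_hereditary_le_power[OF subgroup.equiv_rcong[OF sub is_group] fin])
    show "step_free (\<lambda>x. g \<otimes> x) B" if "step_free (\<lambda>x. g \<otimes> x) A" "B \<subseteq> A" for A B
      using step_free_subset[OF that] .
  next
    fix x assume x: "x \<in> carrier G"
    define p where "p i = x \<otimes> g [^] i" for i :: nat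
    have img: "(rcong ?H) `` {x} = p ` {..<ord g}"
      unfolding subgroup.l_coset_eq_rcong[OF sub is_group x, symmetric]
      unfolding H
      by (auto simp: l_coset_def p_def)
    have inj: "inj_on p {..<ord g}"
    proof (rule inj_onI)
      fix i j assume ij: "i \<in> {..<ord g}" "j \<in> {..<ord g}" "p i = p j"
      then have "g [^] i = g [^] j" using x g(1) by (simp add: p_def)
      then show "i = j" using ord_inj[OF g(1)] ij unfolding ivl by (auto dest: inj_onD)
    qed
    show "real (card {A. A \<subseteq> (rcong ?H) `` {x} \<and> step_free (\<lambda>x. g \<otimes> x) A})
        \<le> (12 / 7) ^ card ((rcong ?H) `` {x})"
      unfolding img
    proof (rule card_path_free_le[OF inj k3])
      fix A i assume "step_free (\<lambda>x. g \<otimes> x) A" "p i \<in> A"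
      moreover have "p (Suc i) = g \<otimes> p i"
        using x g(1) by (simp add: p_def m_ac)
      ultimately show "p (Suc i) \<notin> A" by (auto simp: step_free_def)
    qed
  qed
qed

lemma involution_translation:
  assumes "g \<in> involutions" "x \<in> carrier G"
  shows "g \<otimes> x \<in> carrier G \<and> g \<otimes> (g \<otimes> x) = x \<and> g \<otimes> x \<noteq> x"
  using assms unfolding involutions_def by (auto simp flip: m_assoc)

lemma card_avoiding_involution:
  assumes "finite (carrier G)" "g \<in> involutions"
  shows "card {A. A \<subseteq> carrier G \<and> step_free (\<lambda>x. g \<otimes> x) A} = 3 ^ (order G div 2)"
  unfolding order_def
  by (rule card_step_free_involution[OF assms(1) involution_translation[OF assms(2)]])

lemma card_avoiding_two_involutions:
  assumes fin: "finite (carrier G)" and gh: "g \<in> involutions" "h \<in> involutions" "g \<noteq> h"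
  shows "real (card {A. A \<subseteq> carrier G \<and> step_free (\<lambda>x. g \<otimes> x) A \<and> step_free (\<lambda>x. h \<otimes> x) A})
    \<le> (12 / 7) ^ order G"
proof -
  have [simp]: "g \<in> carrier G" "h \<in> carrier G" using gh by (auto simp: involutions_def)
  show ?thesis
    unfolding order_def
  proof (rule card_step_free_commuting_involutions_generic[OF fin involution_translation[OF gh(1)]])
    fix x assume x: "x \<in> carrier G"
    then have "h \<otimes> x \<noteq> g \<otimes> x" using gh(3) by simp
    then show "h \<otimes> x \<in> carrier G \<and> h \<otimes> (h \<otimes> x) = x \<and> h \<otimes> x \<noteq> x \<and> h \<otimes> x \<noteq> g \<otimes> x"
      using involution_translation[OF gh(2) x] by blast
    show "h \<otimes> (g \<otimes> x) = g \<otimes> (h \<otimes> x)" using x by (simp add: m_ac)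
  qed
qed

text \<open>
  Two solutions of \<open>x \<otimes> x = s\<close> differ by an element of order at most two.
\<close>
lemma card_square_roots_le:
  assumes fin: "finite (carrier G)"
  shows "card {x \<in> carrier G. x \<otimes> x = s} \<le> Suc (card involutions)"
proof (cases "\<exists>y\<in>carrier G. y \<otimes> y = s")
  case False
  then have "{x \<in> carrier G. x \<otimes> x = s} = {}" by blast
  then show ?thesis by (simp only: card.empty)
next
  case True
  then obtain y where y: "y \<in> carrier G" "y \<otimes> y = s" by blast
  have "card {x \<in> carrier G. x \<otimes> x = s} \<le> card (insert \<one> involutions)"
  proof (rule card_inj_on_le[where f = "\<lambda>x. x \<otimes> inv y"])
    show "inj_on (\<lambda>x. x \<otimes> inv y) {x \<in> carrier G. x \<otimes> x = s}"
      using y by (auto simp: inj_on_def)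
    show "(\<lambda>x. x \<otimes> inv y) ` {x \<in> carrier G. x \<otimes> x = s} \<subseteq> insert \<one> involutions"
    proof clarsimp
      fix x assume x: "x \<in> carrier G" "s = x \<otimes> x" "x \<otimes> inv y \<notin> involutions"
      have "(x \<otimes> inv y) \<otimes> (x \<otimes> inv y) = (x \<otimes> x) \<otimes> inv (y \<otimes> y)"
        using x(1) y(1) by (simp add: inv_mult m_ac)
      also have "\<dots> = \<one>" using x y by (metis m_closed r_inv)
      finally show "x \<otimes> inv y = \<one>" using x y by (auto simp: involutions_def)
    qed
    show "finite (insert \<one> involutions)" using fin by (simp add: involutions_def)
  qed
  also have "\<dots> = Suc (card involutions)"
    using fin by (simp add: involutions_def)
  finally show ?thesis .
qed

text \<open>
  The translation and the reflection commute because \<open>g\<close> is its own inverse. The exceptional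
  points are the square roots of \<open>s\<close> (fixed by the reflection) and of \<open>g \<otimes> s\<close> (where reflection and
  translation agree); there are at most \<open>2 (t + 1)\<close> of them, \<open>t\<close> being the number of involutions, which
  accounts for the factor \<open>4\<^sup>t\<^sup>+\<^sup>1\<close>.
\<close>
lemma card_avoiding_involution_and_sum:
  assumes fin: "finite (carrier G)" and g: "g \<in> involutions" and s: "s \<in> carrier G"
  shows "real (card {A. A \<subseteq> carrier G \<and> step_free (\<lambda>x. g \<otimes> x) A \<and> step_free (\<lambda>x. s \<otimes> inv x) A})
    \<le> 4 ^ Suc (card involutions) * (12 / 7) ^ order G"
proof -
  have gG: "g \<in> carrier G" and ginv: "inv g = g"
    using g by (auto simp: involutions_def inv_equality)
  let ?D = "{x \<in> carrier G. s \<otimes> inv x = x \<or> s \<otimes> inv x = g \<otimes> x}"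
  let ?R = "\<lambda>s. {x \<in> carrier G. x \<otimes> x = s}"
  \<comment> \<open>Multiplying the two defining equations by \<open>x\<close> shows that \<open>x\<close> is a square root of \<open>s\<close> or of \<open>g \<otimes> s\<close>.\<close>
  have D: "?D \<subseteq> ?R s \<union> ?R (g \<otimes> s)"
  proof
    fix x assume "x \<in> ?D"
    then have x: "x \<in> carrier G" and *: "s \<otimes> inv x = x \<or> s \<otimes> inv x = g \<otimes> x" by auto
    have sx: "s = (s \<otimes> inv x) \<otimes> x" using x s by (simp add: m_assoc)
    from * show "x \<in> ?R s \<union> ?R (g \<otimes> s)"
    proof
      assume "s \<otimes> inv x = x"
      then show ?thesis using sx x by simp
    next
      assume "s \<otimes> inv x = g \<otimes> x"
      then have "s = g \<otimes> (x \<otimes> x)" using sx x gG by (simp add: m_assoc)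
      then have "g \<otimes> s = x \<otimes> x"
        using involution_translation[OF g, of "x \<otimes> x"] x by simp
      then show ?thesis using x by simp
    qed
  qed
  have "card ?D \<le> card (?R s \<union> ?R (g \<otimes> s))"
    by (rule card_mono[OF _ D]) (use fin in simp)
  also have "\<dots> \<le> 2 * Suc (card involutions)"
    unfolding mult_2
    by (rule order_trans[OF card_Un_le add_mono]) (rule card_square_roots_le[OF fin])+
  finally have "(2::real) ^ card ?D \<le> 2 ^ (2 * Suc (card involutions))"
    by (intro power_increasing) auto
  also have "\<dots> = 4 ^ Suc (card involutions)"
    by (simp only: power_mult) simp
  finally have D4: "(2::real) ^ card ?D \<le> 4 ^ Suc (card involutions)" .
  have "real (card {A. A \<subseteq> carrier G \<and> step_free (\<lambda>x. g \<otimes> x) A \<and> step_free (\<lambda>x. s \<otimes> inv x) A})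
      \<le> 2 ^ card ?D * (12 / 7) ^ card (carrier G)"
  proof (rule card_step_free_commuting_involutions[OF fin involution_translation[OF g]])
    fix x assume x: "x \<in> carrier G"
    have "s \<otimes> inv (s \<otimes> inv x) = (s \<otimes> inv s) \<otimes> x"
      using x s by (simp add: inv_mult flip: m_assoc)
    then show "s \<otimes> inv x \<in> carrier G \<and> s \<otimes> inv (s \<otimes> inv x) = x" using x s by simp
    show "s \<otimes> inv (g \<otimes> x) = g \<otimes> (s \<otimes> inv x)"
      using x s gG by (simp add: inv_mult ginv m_ac)
  qed
  also have "\<dots> \<le> 4 ^ Suc (card involutions) * (12 / 7) ^ order G"
    unfolding order_def by (intro mult_right_mono D4) simp
  finally show ?thesis .
qed

section \<open>The number of MSTD sets of a finite abelian group\<close>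

lemma sumset_subset_carrier: "A \<subseteq> carrier G \<Longrightarrow> sumset G A \<subseteq> carrier G"
  by (auto simp: sumset_def)

lemma diffset_subset_carrier: "A \<subseteq> carrier G \<Longrightarrow> diffset G A \<subseteq> carrier G"
  by (auto simp: diffset_def)

text \<open>
  An MSTD set is nonempty, so it has the difference \<open>\<one>\<close>, and it must miss some other
  difference, as its sumset cannot be larger than the whole group. This is a union bound over the
  missed difference.
\<close>
lemma card_MSTD_le:
  assumes fin: "finite (carrier G)"
  shows "real (card (MSTD G)) \<le> card involutions * 3 ^ (order G div 2) + order G * (12 / 7) ^ order G"
proof -
  let ?E = "\<lambda>g. {A. A \<subseteq> carrier G \<and> step_free (\<lambda>x. g \<otimes> x) A}"
  let ?J = "carrier G - {\<one>} - involutions"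
  have finE: "finite (?E g)" for g
    by (rule finite_subset[of _ "Pow (carrier G)"]) (use fin in auto)
  have finI: "finite involutions" using fin by (simp add: involutions_def)
  have "MSTD G \<subseteq> (\<Union>g\<in>involutions \<union> ?J. ?E g)"
  proof
    fix A assume "A \<in> MSTD G"
    then have A: "A \<subseteq> carrier G" and lt: "card (diffset G A) < card (sumset G A)"
      by (auto simp: MSTD_def)
    have "card (sumset G A) \<le> card (carrier G)"
      by (rule card_mono[OF fin sumset_subset_carrier[OF A]])
    with lt diffset_subset_carrier[OF A] obtain g where g: "g \<in> carrier G" "g \<notin> diffset G A"
      by (metis leD subsetI subset_antisym)
    have "A \<noteq> {}" using lt by (auto simp: sumset_def diffset_def)
    then obtain a where a: "a \<in> A" by blast
    have "\<one> = a \<otimes> inv a" using a A by auto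
    then have "\<one> \<in> diffset G A" using a unfolding diffset_def by blast
    then have "g \<in> involutions \<union> ?J" using g by auto
    moreover have "A \<in> ?E g" using g A not_in_diffset_iff by simp
    ultimately show "A \<in> (\<Union>g\<in>involutions \<union> ?J. ?E g)" by blast
  qed
  then have "card (MSTD G) \<le> card (\<Union>g\<in>involutions \<union> ?J. ?E g)"
    by (rule card_mono[rotated]) (use fin finI finE in blast)
  also have "\<dots> \<le> (\<Sum>g\<in>involutions \<union> ?J. card (?E g))"
    by (rule card_UN_le) (use fin finI in blast)
  also have "\<dots> = (\<Sum>g\<in>involutions. card (?E g)) + (\<Sum>g\<in>?J. card (?E g))"
    by (rule sum.union_disjoint) (use fin finI in auto)
  also have "(\<Sum>g\<in>involutions. card (?E g)) = card involutions * 3 ^ (order G div 2)"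
    using card_avoiding_involution[OF fin] by simp
  finally have "real (card (MSTD G)) \<le> real (card involutions * 3 ^ (order G div 2) + (\<Sum>g\<in>?J. card (?E g)))"
    by (rule of_nat_mono)
  also have "\<dots> = card involutions * 3 ^ (order G div 2) + (\<Sum>g\<in>?J. real (card (?E g)))"
    by simp
  also have "(\<Sum>g\<in>?J. real (card (?E g))) \<le> (\<Sum>g\<in>?J. (12 / 7) ^ order G)"
    by (rule sum_mono) (rule card_avoiding_noninvolution[OF fin], auto simp: involutions_def)
  also have "\<dots> \<le> order G * (12 / 7) ^ order G"
  proof -
    have "card ?J \<le> order G" unfolding order_def by (rule card_mono) (use fin in auto)
    then show ?thesis by (simp add: mult_right_mono)
  qed
  finally show ?thesis by simp
qed

text \<open>
  A set that misses a difference but no sum is MSTD. The sets counted here miss exactly one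
  involution as a difference and miss no sum; sorting them by that involution makes the families
  disjoint, so that no overlaps have to be accounted for.
\<close>
lemma card_MSTD_ge:
  assumes fin: "finite (carrier G)"
  shows "real (card (MSTD G)) \<ge> card involutions * 3 ^ (order G div 2)
    - card involutions * (card involutions + order G * 4 ^ Suc (card involutions)) * (12 / 7) ^ order G"
proof -
  let ?E = "\<lambda>g. {A. A \<subseteq> carrier G \<and> step_free (\<lambda>x. g \<otimes> x) A}"
  let ?S = "\<lambda>s. {A. A \<subseteq> carrier G \<and> step_free (\<lambda>x. s \<otimes> inv x) A}"
  let ?t = "card involutions" and ?c = "(12 / 7 :: real) ^ order G"
  \<comment> \<open>\<open>Bad g\<close> collects the sets that miss \<open>g\<close> and, in addition, another involution or some sum.\<close>
  define Bad where "Bad g = (\<Union>h\<in>involutions - {g}. ?E g \<inter> ?E h) \<union> (\<Union>s\<in>carrier G. ?E g \<inter> ?S s)" for g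
  define Good where "Good g = ?E g - Bad g" for g
  have finE: "finite (?E g)" for g
    by (rule finite_subset[of _ "Pow (carrier G)"]) (use fin in auto)
  have finM: "finite (MSTD G)"
    by (rule finite_subset[of _ "Pow (carrier G)"]) (use fin in \<open>auto simp: MSTD_def\<close>)
  have finI: "finite involutions" using fin by (simp add: involutions_def)
  have Good_MSTD: "Good g \<subseteq> MSTD G" if g: "g \<in> involutions" for g
  proof
    fix A assume "A \<in> Good g"
    then have A: "A \<subseteq> carrier G" and sf: "step_free (\<lambda>x. g \<otimes> x) A"
      and sums: "\<And>s. s \<in> carrier G \<Longrightarrow> \<not> step_free (\<lambda>x. s \<otimes> inv x) A"
      by (auto simp: Good_def Bad_def)
    have gG: "g \<in> carrier G" using g by (simp add: involutions_def)
    have "carrier G \<subseteq> sumset G A" using sums not_in_sumset_iff[OF A] by blast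
    then have "sumset G A = carrier G" using sumset_subset_carrier[OF A] by blast
    moreover have "diffset G A \<subset> carrier G"
      using diffset_subset_carrier[OF A] gG sf not_in_diffset_iff[OF A gG] by blast
    ultimately have "card (diffset G A) < card (sumset G A)"
      using psubset_card_mono[OF fin] by simp
    then show "A \<in> MSTD G" using A fin by (auto simp: MSTD_def intro: finite_subset)
  qed
  have card_Good: "real (card (Good g)) \<ge> 3 ^ (order G div 2) - (?t + order G * 4 ^ Suc ?t) * ?c"
    if g: "g \<in> involutions" for g
  proof -
    have 1: "real (card (\<Union>h\<in>involutions - {g}. ?E g \<inter> ?E h)) \<le> ?t * ?c"
    proof -
      have "card (\<Union>h\<in>involutions - {g}. ?E g \<inter> ?E h) \<le> (\<Sum>h\<in>involutions - {g}. card (?E g \<inter> ?E h))"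
        by (rule card_UN_le) (use finI in simp)
      then have "real (card (\<Union>h\<in>involutions - {g}. ?E g \<inter> ?E h))
          \<le> (\<Sum>h\<in>involutions - {g}. real (card (?E g \<inter> ?E h)))"
        unfolding of_nat_sum[symmetric] by (rule of_nat_mono)
      also have "\<dots> \<le> (\<Sum>h\<in>involutions - {g}. ?c)"
      proof (rule sum_mono)
        fix h assume "h \<in> involutions - {g}"
        moreover have "?E g \<inter> ?E h = {A. A \<subseteq> carrier G \<and> step_free (\<lambda>x. g \<otimes> x) A \<and> step_free (\<lambda>x. h \<otimes> x) A}"
          by auto
        ultimately show "real (card (?E g \<inter> ?E h)) \<le> ?c"
          using card_avoiding_two_involutions[OF fin g, of h] by auto
      qed
      also have "\<dots> \<le> ?t * ?c"
        using card_mono[OF finI, of "involutions - {g}"] by (simp add: mult_right_mono del: card_Diff_insert)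
      finally show ?thesis .
    qed
    have 2: "real (card (\<Union>s\<in>carrier G. ?E g \<inter> ?S s)) \<le> order G * (4 ^ Suc ?t * ?c)"
    proof -
      have "card (\<Union>s\<in>carrier G. ?E g \<inter> ?S s) \<le> (\<Sum>s\<in>carrier G. card (?E g \<inter> ?S s))"
        by (rule card_UN_le[OF fin])
      then have "real (card (\<Union>s\<in>carrier G. ?E g \<inter> ?S s)) \<le> (\<Sum>s\<in>carrier G. real (card (?E g \<inter> ?S s)))"
        unfolding of_nat_sum[symmetric] by (rule of_nat_mono)
      also have "\<dots> \<le> (\<Sum>s\<in>carrier G. 4 ^ Suc ?t * ?c)"
      proof (rule sum_mono)
        fix s assume "s \<in> carrier G"
        moreover have "?E g \<inter> ?S s = {A. A \<subseteq> carrier G \<and> step_free (\<lambda>x. g \<otimes> x) A \<and> step_free (\<lambda>x. s \<otimes> inv x) A}"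
          by auto
        ultimately show "real (card (?E g \<inter> ?S s)) \<le> 4 ^ Suc ?t * ?c"
          using card_avoiding_involution_and_sum[OF fin g, of s] by simp
      qed
      also have "\<dots> = order G * (4 ^ Suc ?t * ?c)" by (simp add: order_def)
      finally show ?thesis .
    qed
    have "real (card (Bad g)) \<le> ?t * ?c + order G * (4 ^ Suc ?t * ?c)"
      using card_Un_le[of "\<Union>h\<in>involutions - {g}. ?E g \<inter> ?E h" "\<Union>s\<in>carrier G. ?E g \<inter> ?S s"] 1 2
      unfolding Bad_def by linarith
    moreover have "real (card (Good g)) \<ge> real (card (?E g)) - real (card (Bad g))"
    proof -
      have "card (Good g) = card (?E g) - card (Bad g)"
      unfolding Good_def
      by (rule card_Diff_subset) (use finite_subset[OF _ finE[of g]] in \<open>auto simp: Bad_def\<close>)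
      then show ?thesis by linarith
    qed
    ultimately show ?thesis
      using card_avoiding_involution[OF fin g] by (simp add: algebra_simps)
  qed
  have disj: "Good g \<inter> Good h = {}" if "g \<in> involutions" "h \<in> involutions" "g \<noteq> h" for g h
    using that unfolding Good_def Bad_def by blast
  have finG: "finite (Good g)" for g using finE[of g] by (simp add: Good_def)
  have "?t * (3 ^ (order G div 2) - (?t + order G * 4 ^ Suc ?t) * ?c)
      = (\<Sum>g\<in>involutions. 3 ^ (order G div 2) - (?t + order G * 4 ^ Suc ?t) * ?c)"
    by simp
  also have "\<dots> \<le> (\<Sum>g\<in>involutions. real (card (Good g)))"
    by (rule sum_mono) (use card_Good in simp)
  also have "\<dots> = real (card (\<Union>g\<in>involutions. Good g))"
    by (subst card_UN_disjoint) (use finI finG disj in auto)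
  also have "\<dots> \<le> real (card (MSTD G))"
    by (intro of_nat_mono card_mono finM UN_least Good_MSTD)
  finally show ?thesis by (simp add: algebra_simps)
qed

end

section \<open>Products of a cyclic group with the group of order two\<close>

lemma comm_group_DirProd:
  assumes "comm_group G" "comm_group H"
  shows "comm_group (G \<times>\<times> H)"
proof -
  interpret G: comm_group G by fact
  interpret H: comm_group H by fact
  show ?thesis
    by (rule group.group_comm_groupI[OF DirProd_group[OF G.is_group H.is_group]])
       (auto simp: G.m_comm H.m_comm)
qed

lemma card_involutions_mod_prod_mod_2:
  assumes "n > 0"
  shows "card (comm_group.involutions (integer_mod_group n \<times>\<times> integer_mod_group 2))
    = (if even n then 3 else 1)"
proof -
  let ?G = "integer_mod_group n \<times>\<times> integer_mod_group 2"
  interpret comm_group ?G by (rule comm_group_DirProd) simp_all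
  have two: "b = 0 \<or> b = 1" if "b \<in> {0..<2}" for b :: int using that by auto
  \<comment> \<open>\<open>2 a - n\<close> is a multiple of \<open>n\<close>, and for \<open>a \<noteq> 0\<close> it lies strictly between \<open>-n\<close> and \<open>n\<close>.\<close>
  have half: "a = 0 \<or> 2 * a = int n" if "0 \<le> a" "a < int n" "(a + a) mod int n = 0" for a
  proof (rule ccontr)
    assume "\<not> ?thesis"
    then have "2 * a - int n \<noteq> 0" "\<bar>2 * a - int n\<bar> < int n" using that(1,2) by linarith+
    moreover have "int n dvd 2 * a - int n" using that(3) by (metis dvd_diff dvd_refl mod_0_imp_dvd mult_2)
    ultimately show False using dvd_imp_le_int[of "2 * a - int n" "int n"] by linarith
  qed
  show ?thesis
  proof (cases "even n")
    case False
    have "involutions = {(0, 1)}"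
    proof
      show "involutions \<subseteq> {(0, 1)}"
      proof clarify
        fix a b assume "(a, b) \<in> involutions"
        then have ab: "0 \<le> a" "a < int n" "(a + a) mod int n = 0" "b \<in> {0..<2}" "(a, b) \<noteq> (0, 0)"
          using assms by (auto simp: involutions_def carrier_integer_mod_group)
        have "2 * a \<noteq> int n" using False by presburger
        with half[OF ab(1-3)] two[OF ab(4)] ab(5) show "a = 0 \<and> b = 1" by auto
      qed
      show "{(0, 1)} \<subseteq> involutions"
        using assms by (auto simp: involutions_def carrier_integer_mod_group)
    qed
    then show ?thesis using False by simp
  next
    case True
    then obtain m where m: "n = 2 * m" by (elim evenE)
    have m0: "m > 0" using m assms by simp
    have "involutions = {(0, 1), (int m, 0), (int m, 1)}"
    proof
      show "involutions \<subseteq> {(0, 1), (int m, 0), (int m, 1)}"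
      proof (rule subrelI)
        fix a b assume "(a, b) \<in> involutions"
        then have ab: "0 \<le> a" "a < int n" "(a + a) mod int n = 0" "b \<in> {0..<2}" "(a, b) \<noteq> (0, 0)"
          using assms by (auto simp: involutions_def carrier_integer_mod_group)
        show "(a, b) \<in> {(0, 1), (int m, 0), (int m, 1)}"
          using half[OF ab(1-3)] two[OF ab(4)] ab(5) m by auto
      qed
      show "{(0, 1), (int m, 0), (int m, 1)} \<subseteq> involutions"
        unfolding involutions_def using m m0 by (auto simp: carrier_integer_mod_group)
    qed
    then show ?thesis using True m0 by simp
  qed
qed

lemma order_mod_prod_mod_2:
  "n > 0 \<Longrightarrow> order (integer_mod_group n \<times>\<times> integer_mod_group 2) = 2 * n"
  by (simp add: order_def carrier_integer_mod_group card_cartesian_product)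

text \<open>
  The relative error decays exponentially because the error rate per element is \<open>12/7\<close>:
  for the \<open>2 n\<close> elements here, \<open>(12/7)\<^sup>2\<^sup>n / 3\<^sup>n = (48/49)\<^sup>n\<close>.
\<close>
lemma card_MSTD_mod_prod_mod_2:
  fixes n :: nat
  defines "M \<equiv> real (card (MSTD (integer_mod_group n \<times>\<times> integer_mod_group 2)))"
    and "T \<equiv> (if even n then 3 ^ (n + 1) else 3 ^ n :: real)"
  assumes "n > 0"
  shows "\<bar>M / T - 1\<bar> \<le> (1538 * real n + 9) * (48 / 49) ^ n"
proof -
  let ?G = "integer_mod_group n \<times>\<times> integer_mod_group 2"
  interpret comm_group ?G by (rule comm_group_DirProd) simp_all
  have fin: "finite (carrier ?G)" using \<open>n > 0\<close> by (simp add: carrier_integer_mod_group)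
  let ?t = "card involutions"
  have t: "?t \<le> 3" and tT: "T = real ?t * 3 ^ n"
    using card_involutions_mod_prod_mod_2[OF \<open>n > 0\<close>] by (auto simp: T_def)
  have c: "(12 / 7 :: real) ^ (2 * n) = (144 / 49) ^ n"
    by (simp add: power_mult power2_eq_square)
  let ?c = "(144 / 49 :: real) ^ n"
  note ord = order_mod_prod_mod_2[OF \<open>n > 0\<close>]
  define err where "err = ?t * (?t + 2 * n * 4 ^ Suc ?t)"
  have "err \<le> 3 * (3 + 2 * n * 4 ^ Suc 3)"
    unfolding err_def using t by (intro mult_mono add_mono power_increasing) auto
  then have "real err \<le> 1536 * real n + 9" by simp
  then have err: "real err * ?c \<le> (1536 * real n + 9) * ?c"
    by (rule mult_right_mono) simp
  have upper: "M \<le> T + (2 * real n) * ?c"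
    using card_MSTD_le[OF fin] unfolding ord c M_def tT by simp
  have lower: "M \<ge> T - real err * ?c"
    using card_MSTD_ge[OF fin] unfolding ord c M_def tT err_def by simp
  have "0 \<le> (2 * real n) * ?c" "0 \<le> (1536 * real n + 9) * ?c" by simp_all
  then have "\<bar>M - T\<bar> \<le> (2 * real n) * ?c + (1536 * real n + 9) * ?c"
    using upper lower err by linarith
  also have "\<dots> = (1538 * real n + 9) * ?c" by (simp add: algebra_simps)
  also have "?c = (48 / 49) ^ n * 3 ^ n" by (simp flip: power_mult_distrib)
  finally have dist: "\<bar>M - T\<bar> \<le> (1538 * real n + 9) * (48 / 49) ^ n * 3 ^ n" by (simp add: mult_ac)
  have T3: "T \<ge> 3 ^ n" by (simp add: T_def)
  then have T0: "T > 0" using zero_less_power[of "3::real" n] by linarith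
  have "\<bar>M / T - 1\<bar> = \<bar>M - T\<bar> / T" using T0 by (simp add: field_simps abs_divide)
  also have "\<dots> \<le> (1538 * real n + 9) * (48 / 49) ^ n * 3 ^ n / 3 ^ n"
    by (rule frac_le) (use dist T3 in auto)
  finally show ?thesis by simp
qed

theorem corollary1p3:
  shows "(\<lambda>n::nat. real (card (MSTD (integer_mod_group n \<times>\<times> integer_mod_group 2))))
           \<sim>[at_top] (\<lambda>n. if even n then 3 ^ (n + 1) else 3 ^ n)"
proof (rule asymp_equivI', rule LIM_zero_cancel, rule tendsto_0_le[where K = 1])
  show "(\<lambda>n. (1538 * real n + 9) * (48 / 49) ^ n) \<longlonglongrightarrow> 0"
    by real_asymp
  show "\<forall>\<^sub>F n in sequentially. norm (real (card (MSTD (integer_mod_group n \<times>\<times> integer_mod_group 2)))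
      / (if even n then 3 ^ (n + 1) else 3 ^ n) - 1) \<le> norm ((1538 * real n + 9) * (48 / 49) ^ n) * 1"
    using eventually_gt_at_top[of 0]
  proof eventually_elim
    case (elim n)
    from card_MSTD_mod_prod_mod_2[OF elim] show ?case by simp
  qed
qed

end
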